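(* Let $0<\lambda\le1$ and let $f\in\mathcal{U}^+(\lambda)$ be of the form $f(z)=z+a_2z^2+a_3z^3+\cdots$. Then: (i) $-(1+\lambda)\lambda\le a_2a_3-a_4\le\frac12\lambda$; (ii) $|a_2a_4-a_5|\le\lambda+\lambda^2+\lambda^3$. These inequalities are sharp.
   Context: Let $\mathbb{D}=\{z\in\mathbb{C}:|z|<1\}$ and let $\mathcal{A}$ be the class of functions $f$ analytic in $\mathbb{D}$ of the form $f(z)=z+a_2z^2+a_3z^3+\cdots$. For $0<\lambda\le1$, $\mathcal{U}^+(\lambda)$ is the class of all $f\in\mathcal{A}$ such that \[ \frac{z}{f(z)}=1+b_1z+b_2z^2+\cdots,\qquad b_n\ge 0\ \text{ for all } n\ge1, \] and \[ \left|\left(\frac{z}{f(z)}\right)^2f'(z)-1\right|<\lambda,\qquad z\in\mathbb{D}. \] "Sharp" means that for each $\lambda\in(0,1]$ equality in each of the given inequalities is attained by some $f\in\mathcal{U}^+(\lambda)$. *)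

theory Defs
  imports "HOL-Complex_Analysis.Complex_Analysis"
begin

definition class_A :: "(complex \<Rightarrow> complex) set" where
  "class_A = {f. f holomorphic_on ball 0 1 \<and> f 0 = 0 \<and> deriv f 0 = 1}"

abbreviation taylor_coeff :: "(complex \<Rightarrow> complex) \<Rightarrow> nat \<Rightarrow> complex" where
  "taylor_coeff f n \<equiv> fps_nth (fps_expansion f 0) n"

text \<open>For \<open>f\<close> in \<open>class_A\<close> the function \<open>z / f z\<close> has a removable singularity at \<open>0\<close>
  with value \<open>1\<close>; the HOL value \<open>0 / f 0 = 0\<close> is replaced accordingly.\<close>

definition z_over :: "(complex \<Rightarrow> complex) \<Rightarrow> complex \<Rightarrow> complex" where
  "z_over f z = (if z = 0 then 1 else z / f z)"

text \<open>The condition \<open>f z \<noteq> 0\<close> makes explicit that \<open>z / f z\<close> is defined on the punctured disc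
  (HOL division by zero yields \<open>0\<close>). The constant term \<open>b 0 = 1\<close> is forced by the series
  identity at \<open>z = 0\<close>.\<close>

definition U_plus :: "real \<Rightarrow> (complex \<Rightarrow> complex) set" where
  "U_plus lam = {f \<in> class_A.
     (\<forall>z\<in>ball 0 1 - {0}. f z \<noteq> 0) \<and>
     (\<exists>b :: nat \<Rightarrow> real. (\<forall>n\<ge>1. 0 \<le> b n) \<and>
        (\<forall>z\<in>ball 0 1. (\<lambda>n. complex_of_real (b n) * z ^ n) sums z_over f z)) \<and>
     (\<forall>z\<in>ball 0 1. cmod ((z_over f z)\<^sup>2 * deriv f z - 1) < lam)}"

end

theory Submission
  imports Defs
begin

text \<open>
  Put \<open>g = z / f = 1 + b\<^sub>1 z + b\<^sub>2 z\<^sup>2 + \<dots>\<close>. Then \<open>(z / f)\<^sup>2 f' = g - z g'\<close>, so the \<open>U\<close>-condition reads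
  \<open>\<bar>\<Sum>n\<ge>2. (n - 1) b\<^sub>n z\<^sup>n\<bar> < \<lambda>\<close>, and letting \<open>z \<rightarrow> 1\<close> gives \<open>b\<^sub>2 + 2 b\<^sub>3 + 3 b\<^sub>4 \<le> \<lambda>\<close>. As \<open>g\<close> has no zero
  in the disc, it is positive on \<open>(-1, 0)\<close>; letting \<open>z \<rightarrow> -1\<close> and estimating the terms with \<open>n \<ge> 3\<close> by the
  previous sum gives \<open>b\<^sub>1 \<le> 1 + (2 b\<^sub>2 + \<lambda>) / 3\<close>. Since
  \<open>a\<^sub>2 a\<^sub>3 - a\<^sub>4 = b\<^sub>3 - b\<^sub>1 b\<^sub>2\<close> and \<open>a\<^sub>2 a\<^sub>4 - a\<^sub>5 = b\<^sub>1\<^sup>2 b\<^sub>2 - b\<^sub>2\<^sup>2 - b\<^sub>1 b\<^sub>3 + b\<^sub>4\<close>, the bounds follow.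
  Equality occurs for \<open>g = (1 + z) (1 + \<lambda> z)\<close> and for \<open>g = 1 + \<lambda> z\<^sup>3 / 2\<close>.
\<close>

section \<open>Power series of z / f and the class condition\<close>

abbreviation real_fps :: "(nat \<Rightarrow> real) \<Rightarrow> complex fps" where
  "real_fps b \<equiv> Abs_fps (\<lambda>n. complex_of_real (b n))"

lemma eval_minus_X_deriv:
  fixes B :: "complex fps"
  assumes "cmod z < fps_conv_radius B"
  shows "eval_fps (B - fps_X * fps_deriv B) z = eval_fps B z - z * eval_fps (fps_deriv B) z"
    and "cmod z < fps_conv_radius (B - fps_X * fps_deriv B)"
proof -
  have d: "cmod z < fps_conv_radius (fps_deriv B)"
    using assms fps_conv_radius_deriv[of B] by (rule less_le_trans)
  have m: "cmod z < fps_conv_radius (fps_X * fps_deriv B)"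
    using d fps_conv_radius_mult[of fps_X "fps_deriv B"] by (auto intro: less_le_trans)
  show "eval_fps (B - fps_X * fps_deriv B) z = eval_fps B z - z * eval_fps (fps_deriv B) z"
    using assms d m by (simp add: eval_fps_diff eval_fps_mult)
  show "cmod z < fps_conv_radius (B - fps_X * fps_deriv B)"
    using assms m fps_conv_radius_diff[of B "fps_X * fps_deriv B"]
    by (meson less_le_trans min_less_iff_conj)
qed

text \<open>By the quotient rule f' = (g - z g') / g^2 with g = \<open>eval_fps B\<close>, so
  multiplying by g^2 leaves an expression linear in the coefficients of g.\<close>

lemma deriv_divide_eval_fps:
  fixes B :: "complex fps"
  assumes "fps_conv_radius B \<ge> 1" "z \<in> ball 0 1" "eval_fps B z \<noteq> 0"
    and eq: "\<And>w. w \<in> ball 0 1 \<Longrightarrow> f w = w / eval_fps B w"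
  shows "(eval_fps B z)\<^sup>2 * deriv f z = eval_fps (B - fps_X * fps_deriv B) z"
proof -
  have z: "cmod z < fps_conv_radius B"
    using assms(1,2) by (auto intro: less_le_trans[of _ 1])
  have "((\<lambda>w. w / eval_fps B w) has_field_derivative
      (1 * eval_fps B z - z * eval_fps (fps_deriv B) z) / (eval_fps B z * eval_fps B z)) (at z)"
    by (intro DERIV_divide DERIV_ident has_field_derivative_eval_fps z assms(3))
  then have "(f has_field_derivative
      (1 * eval_fps B z - z * eval_fps (fps_deriv B) z) / (eval_fps B z * eval_fps B z)) (at z)"
    by (rule has_field_derivative_transform_within_open[OF _ open_ball assms(2)])
      (simp add: eq)
  then have "deriv f z = eval_fps (B - fps_X * fps_deriv B) z / (eval_fps B z)\<^sup>2"
    using eval_minus_X_deriv(1)[OF z] by (simp add: DERIV_imp_deriv power2_eq_square)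
  then show ?thesis
    using assms(3) by simp
qed

text \<open>Membership in \<open>U_plus lam\<close> expressed through the coefficients of z / f
  alone; the difference inside \<open>cmod\<close> is the power series of (z / f)^2 f'.\<close>

definition U_series :: "real \<Rightarrow> (nat \<Rightarrow> real) \<Rightarrow> bool" where
  "U_series lam b \<longleftrightarrow> b 0 = 1 \<and> (\<forall>n\<ge>1. 0 \<le> b n) \<and> fps_conv_radius (real_fps b) \<ge> 1 \<and>
     (\<forall>z\<in>ball 0 1. eval_fps (real_fps b) z \<noteq> 0 \<and>
        cmod (eval_fps (real_fps b - fps_X * fps_deriv (real_fps b)) z - 1) < lam)"

lemma U_plusE:
  assumes "f \<in> U_plus lam"
  obtains b where "U_series lam b" "\<And>z. z \<in> ball 0 1 \<Longrightarrow> f z = z / eval_fps (real_fps b) z"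
proof -
  from assms obtain b where f: "f \<in> class_A" "\<And>z. z \<in> ball 0 1 - {0} \<Longrightarrow> f z \<noteq> 0"
    and b: "\<And>n. n \<ge> 1 \<Longrightarrow> 0 \<le> b n"
      "\<And>z. z \<in> ball 0 1 \<Longrightarrow> (\<lambda>n. complex_of_real (b n) * z ^ n) sums z_over f z"
    and lam: "\<And>z. z \<in> ball 0 1 \<Longrightarrow> cmod ((z_over f z)\<^sup>2 * deriv f z - 1) < lam"
    unfolding U_plus_def by blast
  have eval: "eval_fps (real_fps b) z = z_over f z" if "z \<in> ball 0 1" for z
    using b(2)[OF that] by (simp add: eval_fps_def sums_iff)
  have rad: "fps_conv_radius (real_fps b) \<ge> 1"
    unfolding fps_conv_radius_def
  proof (rule conv_radius_geI_ex')
    fix r :: real assume "0 < r" "ereal r < 1"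
    then show "summable (\<lambda>n. fps_nth (real_fps b) n * complex_of_real r ^ n)"
      using b(2)[of "complex_of_real r"] by (auto simp: sums_iff)
  qed
  have "eval_fps (real_fps b) 0 = 1"
    by (simp add: eval z_over_def)
  then have b0: "b 0 = 1"
    by (simp add: eval_fps_at_0)
  have f0: "f 0 = 0"
    using f(1) by (simp add: class_A_def)
  have nz: "eval_fps (real_fps b) z \<noteq> 0" if "z \<in> ball 0 1" for z
    using f(2)[of z] that by (auto simp: eval z_over_def)
  have feq: "f z = z / eval_fps (real_fps b) z" if "z \<in> ball 0 1" for z
    using that f0 f(2)[of z] by (auto simp: eval z_over_def)
  have "cmod (eval_fps (real_fps b - fps_X * fps_deriv (real_fps b)) z - 1) < lam"
    if "z \<in> ball 0 1" for z
    using lam[OF that] deriv_divide_eval_fps[OF rad that nz[OF that] feq] eval[OF that] by simp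
  then have "U_series lam b"
    using b(1) b0 rad nz by (auto simp: U_series_def)
  then show ?thesis
    using feq that by blast
qed

text \<open>Converse of \<open>U_plusE\<close>; it turns the extremal coefficient sequences into
  members of the class.\<close>

lemma U_plusI:
  assumes "U_series lam b"
  shows "(\<lambda>z. z / eval_fps (real_fps b) z) \<in> U_plus lam"
proof -
  let ?g = "eval_fps (real_fps b)"
  let ?f = "\<lambda>z. z / ?g z"
  have b: "b 0 = 1" "\<And>n. n \<ge> 1 \<Longrightarrow> 0 \<le> b n" "fps_conv_radius (real_fps b) \<ge> 1"
    "\<And>z. z \<in> ball 0 1 \<Longrightarrow> ?g z \<noteq> 0"
    "\<And>z. z \<in> ball 0 1 \<Longrightarrow> cmod (eval_fps (real_fps b - fps_X * fps_deriv (real_fps b)) z - 1) < lam"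
    using assms by (auto simp: U_series_def)
  have rad: "cmod z < fps_conv_radius (real_fps b)" if "z \<in> ball 0 1" for z
    using that b(3) by (auto intro: less_le_trans[of _ 1])
  have g0: "?g 0 = 1"
    by (simp add: eval_fps_at_0 b)
  have zf: "z_over ?f z = ?g z" if "z \<in> ball 0 1" for z
    using b(4)[OF that] g0 by (auto simp: z_over_def)
  have der: "(?g z)\<^sup>2 * deriv ?f z = eval_fps (real_fps b - fps_X * fps_deriv (real_fps b)) z"
    if "z \<in> ball 0 1" for z
    using b(3,4) that by (intro deriv_divide_eval_fps) auto
  \<comment> \<open>At 0 both g and g - z g' equal 1, so the normalisation is a special case of the
    quotient formula.\<close>
  have "deriv ?f 0 = 1"
    using der[of 0] g0 by (simp add: eval_fps_at_0 b)
  moreover have "?f holomorphic_on ball 0 1"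
    using b(4) rad by (intro holomorphic_intros) auto
  ultimately have A: "?f \<in> class_A"
    by (simp add: class_A_def)
  have "(\<lambda>n. complex_of_real (b n) * z ^ n) sums z_over ?f z" if "z \<in> ball 0 1" for z
    using sums_eval_fps[OF rad[OF that]] zf[OF that] by simp
  then have "\<exists>b :: nat \<Rightarrow> real. (\<forall>n\<ge>1. 0 \<le> b n) \<and>
      (\<forall>z\<in>ball 0 1. (\<lambda>n. complex_of_real (b n) * z ^ n) sums z_over ?f z)"
    using b(2) by blast
  with A show ?thesis
    using b(4,5) zf der unfolding U_plus_def by auto
qed

section \<open>Taylor coefficients of f in terms of those of z / f\<close>

lemma U_plus_coeffs:
  assumes "U_series lam b" "\<And>z. z \<in> ball 0 1 \<Longrightarrow> f z = z / eval_fps (real_fps b) z"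
  defines "a \<equiv> taylor_coeff f"
  shows "a 2 * a 3 - a 4 = complex_of_real (b 3 - b 1 * b 2)"
    and "a 2 * a 4 - a 5 = complex_of_real ((b 1)\<^sup>2 * b 2 - (b 2)\<^sup>2 - b 1 * b 3 + b 4)"
proof -
  let ?B = "real_fps b"
  let ?F = "fps_expansion f 0"
  have b: "b 0 = 1" "fps_conv_radius ?B \<ge> 1"
    using assms(1) by (auto simp: U_series_def)
  have "fps_conv_radius ?B > 0"
    using b(2) by (auto intro: less_le_trans[of _ 1])
  then have "(\<lambda>z. z / eval_fps ?B z) has_fps_expansion fps_X / ?B"
    using b(1) by (intro fps_expansion_intros eval_fps_has_fps_expansion) auto
  moreover have "eventually (\<lambda>z. z / eval_fps ?B z = f z) (nhds 0)"
    using assms(2) eventually_nhds_in_open[of "ball 0 1" "0 :: complex"]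
    by (auto elim!: eventually_mono)
  ultimately have "f has_fps_expansion fps_X / ?B"
    using has_fps_expansion_cong by metis
  then have "?F = fps_X / ?B"
    by (rule fps_expansion_eqI)
  \<comment> \<open>\<open>?B\<close> is a unit because its constant term is 1; comparing
    coefficients in this product determines the a_n recursively.\<close>
  then have FB: "?F * ?B = fps_X"
    using b(1) by (simp add: fps_divide_unit mult.assoc inverse_mult_eq_1)
  have nth: "(\<Sum>i=0..n. fps_nth ?F i * complex_of_real (b (n - i))) = (if n = 1 then 1 else 0)" for n
    using arg_cong[OF FB, of "\<lambda>h. fps_nth h n"] by (simp add: fps_mult_nth)
  note c = nth[of 0] nth[of 1] nth[of 2] nth[of 3] nth[of 4] nth[of 5]
  have a0: "a 0 = 0"
    using c(1) b(1) by (simp add: a_def)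
  have a1: "a 1 = 1"
    using c(2) b(1) a0 by (simp add: a_def)
  have a2: "a 2 = - b 1"
    using c(3) b(1) a0 a1 by (simp add: a_def numeral_eq_Suc add_eq_0_iff)
  have a3: "a 3 = - b 2 - a 2 * b 1"
    using c(4) b(1) a0 a1 by (simp add: a_def numeral_eq_Suc add_eq_0_iff)
  have a4: "a 4 = - b 3 - a 2 * b 2 - a 3 * b 1"
    using c(5) b(1) a0 a1 by (simp add: a_def numeral_eq_Suc add_eq_0_iff)
  have a5: "a 5 = - b 4 - a 2 * b 3 - a 3 * b 2 - a 4 * b 1"
    using c(6) b(1) a0 a1 by (simp add: a_def numeral_eq_Suc add_eq_0_iff)
  show "a 2 * a 3 - a 4 = complex_of_real (b 3 - b 1 * b 2)"
    by (simp add: a4 a3 a2 algebra_simps)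
  show "a 2 * a 4 - a 5 = complex_of_real ((b 1)\<^sup>2 * b 2 - (b 2)\<^sup>2 - b 1 * b 3 + b 4)"
    by (simp add: a5 a4 a3 a2 algebra_simps power2_eq_square)
qed

section \<open>Coefficient inequalities from radial limits\<close>

lemma le_at_one_by_limit:
  fixes p :: "real \<Rightarrow> real"
  assumes "isCont p 1" "\<And>r. 0 < r \<Longrightarrow> r < 1 \<Longrightarrow> p r \<le> c"
  shows "p 1 \<le> c"
proof (rule tendsto_upperbound[of p _ "at_left 1"])
  show "(p \<longlongrightarrow> p 1) (at_left 1)"
    using assms(1) by (auto simp: isCont_def intro: filterlim_at_split[THEN iffD1, THEN conjunct1])
  show "\<forall>\<^sub>F r in at_left 1. p r \<le> c"
    by (rule eventually_mono[OF eventually_at_left_real[of 0 1]]) (use assms(2) in auto)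
qed simp

text \<open>Real coefficients make g real on (-1, 1), so it is its real part that cannot vanish
  there. In the last claim the term for \<open>n = 0\<close> is -1 and the one for
  \<open>n = 1\<close> is 0, so \<open>s\<close> is the sum over \<open>n \<ge> 2\<close>.\<close>

lemma U_series_sums:
  assumes "U_series lam b" "\<bar>r\<bar> < 1"
  defines "g \<equiv> \<lambda>x. Re (eval_fps (real_fps b) (complex_of_real x))"
  shows "(\<lambda>n. b n * r ^ n) sums g r"
    and "g r \<noteq> 0"
    and "\<exists>s<lam. (\<lambda>n. (real n - 1) * b n * r ^ n) sums (s - 1)"
proof -
  let ?z = "complex_of_real r"
  let ?B = "real_fps b"
  let ?D = "?B - fps_X * fps_deriv ?B"
  have z: "?z \<in> ball 0 1" "cmod ?z < fps_conv_radius ?B"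
    using assms(1,2) by (auto simp: U_series_def intro: less_le_trans[of _ 1])
  have S: "(\<lambda>n. complex_of_real (b n * r ^ n)) sums eval_fps ?B ?z"
    using sums_eval_fps[OF z(2)] by simp
  from sums_Re[OF S] show "(\<lambda>n. b n * r ^ n) sums g r"
    by (simp add: g_def)
  have "Im (eval_fps ?B ?z) = 0"
    using sums_Im[OF S] by (simp add: sums_iff)
  moreover have "eval_fps ?B ?z \<noteq> 0"
    using assms(1) z(1) by (auto simp: U_series_def)
  ultimately show "g r \<noteq> 0"
    by (simp add: g_def complex_eq_iff)
  have nth: "fps_nth ?D n = complex_of_real ((1 - real n) * b n)" for n
    by (cases n) (simp_all add: algebra_simps)
  have "(\<lambda>n. complex_of_real ((1 - real n) * b n * r ^ n)) sums eval_fps ?D ?z"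
    using sums_eval_fps[OF eval_minus_X_deriv(2)[OF z(2)]] by (simp only: nth) simp
  from sums_minus[OF sums_Re[OF this]]
  have "(\<lambda>n. (real n - 1) * b n * r ^ n) sums (- Re (eval_fps ?D ?z))"
    by (simp add: algebra_simps)
  moreover have "cmod (eval_fps ?D ?z - 1) < lam"
    using assms(1) z(1) by (auto simp: U_series_def)
  then have "1 - Re (eval_fps ?D ?z) < lam"
    using abs_Re_le_cmod[of "eval_fps ?D ?z - 1"] by simp
  ultimately show "\<exists>s<lam. (\<lambda>n. (real n - 1) * b n * r ^ n) sums (s - 1)"
    by (intro exI[of _ "1 - Re (eval_fps ?D ?z)"]) simp
qed

lemma U_series_weighted_sum:
  assumes "U_series lam b"
  shows "b 2 + 2 * b 3 + 3 * b 4 \<le> lam"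
proof -
  have "b 2 * r ^ 2 + 2 * b 3 * r ^ 3 + 3 * b 4 * r ^ 4 \<le> lam" if r: "0 < r" "r < 1" for r
  proof -
    obtain s where s: "s < lam" "(\<lambda>n. (real n - 1) * b n * r ^ n) sums (s - 1)"
      using U_series_sums(3)[OF assms, of r] r by auto
    \<comment> \<open>The omitted terms are nonnegative; the -1 from \<open>n = 0\<close> cancels
      against the one in \<open>s - 1\<close>.\<close>
    have "(\<Sum>n<5. (real n - 1) * b n * r ^ n) \<le> (\<Sum>n. (real n - 1) * b n * r ^ n)"
      using assms r s(2) by (intro sum_le_suminf) (auto simp: U_series_def sums_iff)
    then show ?thesis
      using s assms by (simp add: sums_iff eval_nat_numeral U_series_def)
  qed
  from le_at_one_by_limit[of "\<lambda>r. b 2 * r ^ 2 + 2 * b 3 * r ^ 3 + 3 * b 4 * r ^ 4", OF _ this]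
  show ?thesis by simp
qed

text \<open>A nonpositive value would, by the intermediate value theorem and g(0) = 1, force a zero
  in (-1, 0).\<close>

lemma U_series_pos:
  assumes "U_series lam b" "0 < r" "r < 1"
  shows "Re (eval_fps (real_fps b) (complex_of_real (- r))) > 0"
proof (rule ccontr)
  let ?g = "\<lambda>x. Re (eval_fps (real_fps b) (complex_of_real x))"
  assume "\<not> ?thesis"
  moreover have "?g 0 = 1"
    using assms(1) by (simp add: eval_fps_at_0 U_series_def)
  moreover have "continuous_on {-r..0} ?g"
    using assms
    by (intro continuous_intros) (auto simp: U_series_def intro!: less_le_trans[of _ 1 "fps_conv_radius _"])
  ultimately obtain x where "-r \<le> x" "x \<le> 0" "?g x = 0"
    using IVT'[of ?g "-r" 0 0] assms by auto
  with U_series_sums(2)[OF assms(1), of x] assms show False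
    by auto
qed

lemma U_series_b1_le:
  assumes "U_series lam b"
  shows "b 1 \<le> 1 + (2 * b 2 + lam) / 3"
proof -
  have "b 1 * r - 2 / 3 * b 2 * r ^ 2 \<le> 1 + lam / 3" if r: "0 < r" "r < 1" for r
  proof -
    \<comment> \<open>Corrections for \<open>n < 3\<close>, where the termwise comparison of b_n
      (-r)^n with (n - 1) b_n r^n / 3 needs adjusting; with them, equality holds at these
      indices.\<close>
    let ?c = "\<lambda>n :: nat. if n = 0 then 4/3 else if n = 1 then - b 1 * r else if n = 2 then 2/3 * b 2 * r ^ 2 else 0"
    obtain s where s: "s < lam" "(\<lambda>n. (real n - 1) * b n * r ^ n) sums (s - 1)"
      using U_series_sums(3)[OF assms, of r] r by auto
    have le: "b n * (- r) ^ n \<le> (real n - 1) * b n * r ^ n / 3 + ?c n" for n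
    proof -
      have bn: "0 \<le> b n * r ^ n"
        using assms r by (cases "n = 0") (auto simp: U_series_def)
      \<comment> \<open>The factor 1/3 is fixed by \<open>n = 4\<close>, the first even index beyond
        the corrections, where (n - 1) / 3 = 1. At \<open>n = 3\<close> the left side is
        nonpositive.\<close>
      consider "n = 0" | "n = 1" | "n = 2" | "n = 3" | "n \<ge> 4" by linarith
      then show ?thesis
      proof cases
        case 5
        have "b n * (- r) ^ n \<le> b n * r ^ n"
          using bn by (cases "even n") auto
        also have "\<dots> \<le> (real n - 1) / 3 * (b n * r ^ n)"
          using bn 5 mult_right_mono[of 1 "(real n - 1) / 3" "b n * r ^ n"] by simp
        finally show ?thesis using 5 by simp
      qed (use assms bn in \<open>auto simp: U_series_def\<close>)
    qed
    have "?c sums sum ?c {..<3}"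
      by (intro sums_finite) auto
    then have "(\<lambda>n. (real n - 1) * b n * r ^ n / 3 + ?c n) sums ((s - 1) / 3 + sum ?c {..<3})"
      by (intro sums_add sums_divide s(2))
    then have "Re (eval_fps (real_fps b) (complex_of_real (- r))) \<le> (s - 1) / 3 + sum ?c {..<3}"
      using U_series_sums(1)[OF assms, of "- r"] r by (intro sums_le[OF le]) auto
    moreover have "sum ?c {..<3} = 4 / 3 - b 1 * r + 2 / 3 * b 2 * r ^ 2"
      by (simp add: eval_nat_numeral)
    ultimately show ?thesis
      using U_series_pos[OF assms r] s(1) by argo
  qed
  from le_at_one_by_limit[of "\<lambda>r. b 1 * r - 2 / 3 * b 2 * r ^ 2", OF _ this]
  show ?thesis by (simp add: field_simps)
qed

section \<open>Real estimates for the two coefficient functionals\<close>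

lemma coeff_bounds:
  fixes lam b1 b2 b3 b4 :: real
  assumes "0 < lam" "lam \<le> 1" "0 \<le> b1" "0 \<le> b2" "0 \<le> b3" "0 \<le> b4"
    and sum: "b2 + 2 * b3 + 3 * b4 \<le> lam" and b1: "b1 \<le> 1 + (2 * b2 + lam) / 3"
  shows "- (1 + lam) * lam \<le> b3 - b1 * b2" "b3 - b1 * b2 \<le> lam / 2"
    and "\<bar>b1\<^sup>2 * b2 - b2\<^sup>2 - b1 * b3 + b4\<bar> \<le> lam + lam\<^sup>2 + lam ^ 3"
proof -
  have b2: "b2 \<le> lam"
    using assms by simp
  then have b1': "b1 \<le> 1 + lam"
    using b1 by argo
  have "b1 * b2 \<le> (1 + lam) * lam"
    using assms b1' b2 by (intro mult_mono) auto
  then show "- (1 + lam) * lam \<le> b3 - b1 * b2"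
    using assms by (simp add: algebra_simps)
  have "0 \<le> b1 * b2"
    using assms by simp
  then show "b3 - b1 * b2 \<le> lam / 2"
    using sum \<open>0 \<le> b2\<close> \<open>0 \<le> b4\<close> by argo
  \<comment> \<open>The amount by which the bound on \<open>b1\<close> exceeds 1. Expanding (1 +
    t)^2 splits the upper estimate into three parts, matched with lam, lam^2 and lam^3;
    \<open>b4\<close> joins the first, since b2 + b4 \<le> lam.\<close>
  define t where "t = (2 * b2 + lam) / 3"
  have t: "0 \<le> t" "t \<le> lam" "b1 \<le> 1 + t"
    using assms b2 by (auto simp: t_def)
  have "b1\<^sup>2 * b2 \<le> (1 + t)\<^sup>2 * b2"
    using assms t by (intro mult_right_mono power_mono) auto
  also have "\<dots> = b2 + b2 * (2 * t - b2) + b2 * t\<^sup>2 + b2\<^sup>2"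
    by (simp add: algebra_simps power2_eq_square)
  finally have 1: "b1\<^sup>2 * b2 - b2\<^sup>2 \<le> b2 + b2 * (2 * t - b2) + b2 * t\<^sup>2"
    by simp
  have "2 * t - b2 \<le> lam" "0 \<le> 2 * t - b2"
    using assms(1,4) b2 unfolding t_def by argo+
  then have 2: "b2 * (2 * t - b2) \<le> lam * lam"
    using assms(1) b2 by (intro mult_mono) auto
  have 3: "b2 * t\<^sup>2 \<le> lam * lam\<^sup>2"
    using assms b2 t by (intro mult_mono power_mono) auto
  have 4: "0 \<le> b1 * b3"
    using assms by simp
  have upper: "b1\<^sup>2 * b2 - b2\<^sup>2 - b1 * b3 + b4 \<le> lam + lam\<^sup>2 + lam ^ 3"
    using 1 2 3 4 sum \<open>0 \<le> b3\<close> \<open>0 \<le> b4\<close>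
    unfolding power3_eq_cube power2_eq_square mult.assoc by linarith
  \<comment> \<open>For the lower bound, b2 \<le> 1 and b1 \<le> 2 reduce the negative terms to b2 +
    2 b3, which is at most lam.\<close>
  have "b2\<^sup>2 \<le> 1 * b2"
    unfolding power2_eq_square using assms b2 by (intro mult_right_mono) auto
  moreover have "b1 * b3 \<le> 2 * b3"
    using assms b1' by (intro mult_right_mono) auto
  moreover have "0 \<le> b1\<^sup>2 * b2" "0 \<le> lam\<^sup>2" "0 \<le> lam ^ 3"
    using assms by auto
  ultimately have "- (lam + lam\<^sup>2 + lam ^ 3) \<le> b1\<^sup>2 * b2 - b2\<^sup>2 - b1 * b3 + b4"
    using assms by linarith
  with upper show "\<bar>b1\<^sup>2 * b2 - b2\<^sup>2 - b1 * b3 + b4\<bar> \<le> lam + lam\<^sup>2 + lam ^ 3"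
    by (simp add: abs_le_iff)
qed

section \<open>Extremal polynomials\<close>

text \<open>A polynomial has infinite radius of convergence, so only the pointwise conditions
  remain; \<open>pCons 0 (pderiv p)\<close> is the polynomial X p'.\<close>

lemma U_series_poly:
  fixes p :: "real poly"
  assumes "coeff p 0 = 1" "\<And>n. 0 \<le> coeff p n"
    and "\<And>z. z \<in> ball 0 1 \<Longrightarrow> poly (map_poly complex_of_real p) z \<noteq> 0"
    and "\<And>z. z \<in> ball 0 1 \<Longrightarrow> cmod (poly (map_poly complex_of_real (p - pCons 0 (pderiv p))) z - 1) < lam"
  shows "U_series lam (coeff p)"
proof -
  have B: "real_fps (coeff p) = fps_of_poly (map_poly complex_of_real p)"
    by (simp add: fps_eq_iff coeff_map_poly)
  have D: "fps_of_poly (map_poly complex_of_real p)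
      - fps_X * fps_deriv (fps_of_poly (map_poly complex_of_real p))
      = fps_of_poly (map_poly complex_of_real (p - pCons 0 (pderiv p)))"
  proof (rule fps_ext)
    show "fps_nth (fps_of_poly (map_poly complex_of_real p)
      - fps_X * fps_deriv (fps_of_poly (map_poly complex_of_real p))) n
      = fps_nth (fps_of_poly (map_poly complex_of_real (p - pCons 0 (pderiv p)))) n" for n
      by (cases n) (simp_all add: coeff_map_poly coeff_pderiv)
  qed
  show ?thesis
    using assms by (simp add: U_series_def B D)
qed

text \<open>The polynomial is g = (1 + z) (1 + lam z), whose zeros -1 and -1 / lam lie outside the
  open disc, and g - z g' - 1 = -lam z^2. It attains the lower bound in (i) and the bound in
  (ii).\<close>

lemma U_series_quadratic:
  assumes "0 < lam" "lam \<le> 1"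
  shows "U_series lam (coeff [:1, 1 + lam, lam:])"
proof (rule U_series_poly)
  fix z :: complex assume z: "z \<in> ball 0 1"
  have "1 + z \<noteq> 0"
    using z by (auto simp: add_eq_0_iff)
  moreover have lz: "cmod (of_real lam * z) < 1"
    using z assms mult_left_le_one_le[of "cmod z" lam] by (simp add: norm_mult)
  then have "1 + of_real lam * z \<noteq> 0"
    by (auto simp: add_eq_0_iff)
  ultimately have "(1 + z) * (1 + of_real lam * z) \<noteq> 0"
    by simp
  then show "poly (map_poly complex_of_real [:1, 1 + lam, lam:]) z \<noteq> 0"
    using assms by (simp add: map_poly_pCons algebra_simps)
  have "cmod z ^ 2 < 1"
    using z by (simp add: power_less_one_iff)
  then show "cmod (poly (map_poly complex_of_real ([:1, 1 + lam, lam:]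
      - pCons 0 (pderiv [:1, 1 + lam, lam:]))) z - 1) < lam"
    using assms by (simp add: map_poly_pCons pderiv_pCons norm_mult power2_eq_square)
qed (use assms in \<open>auto simp: coeff_pCons split: nat.split\<close>)

text \<open>Here g - z g' - 1 = -lam z^3: the coefficient lam / 2 compensates the weight n - 1 = 2.
  With b1 = b2 = 0 it attains the upper bound in (i).\<close>

lemma U_series_cubic:
  assumes "0 < lam" "lam \<le> 1"
  shows "U_series lam (coeff [:1, 0, 0, lam / 2:])"
proof (rule U_series_poly)
  fix z :: complex assume z: "z \<in> ball 0 1"
  have z3: "cmod z ^ 3 < 1"
    using z by (simp add: power_less_one_iff)
  have l3: "cmod (of_real lam * z ^ 3) < lam"
    using z3 assms by (simp add: norm_mult norm_power)
  moreover have "cmod (of_real (lam / 2) * z ^ 3) = cmod (of_real lam * z ^ 3) / 2"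
    by (simp add: norm_mult)
  ultimately have "cmod (of_real (lam / 2) * z ^ 3) < 1"
    using assms by linarith
  then have "1 + of_real (lam / 2) * z ^ 3 \<noteq> 0"
    by (auto simp: add_eq_0_iff)
  then show "poly (map_poly complex_of_real [:1, 0, 0, lam / 2:]) z \<noteq> 0"
    using assms by (simp add: map_poly_pCons power3_eq_cube algebra_simps)
  show "cmod (poly (map_poly complex_of_real ([:1, 0, 0, lam / 2:]
      - pCons 0 (pderiv [:1, 0, 0, lam / 2:]))) z - 1) < lam"
    using l3 assms by (simp add: map_poly_pCons pderiv_pCons norm_mult power3_eq_cube)
qed (use assms in \<open>auto simp: coeff_pCons split: nat.split\<close>)

theorem theorem5:
  fixes lam :: real
  assumes "0 < lam" and "lam \<le> 1"
  shows "(\<forall>f\<in>U_plus lam.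
            let a = taylor_coeff f in
              a 2 * a 3 - a 4 \<in> \<real> \<and>
              - (1 + lam) * lam \<le> Re (a 2 * a 3 - a 4) \<and>
              Re (a 2 * a 3 - a 4) \<le> lam / 2 \<and>
              cmod (a 2 * a 4 - a 5) \<le> lam + lam\<^sup>2 + lam ^ 3)
       \<and> (\<exists>f\<in>U_plus lam. let a = taylor_coeff f in
              a 2 * a 3 - a 4 = complex_of_real (- (1 + lam) * lam))
       \<and> (\<exists>f\<in>U_plus lam. let a = taylor_coeff f in
              a 2 * a 3 - a 4 = complex_of_real (lam / 2))
       \<and> (\<exists>f\<in>U_plus lam. let a = taylor_coeff f in
              cmod (a 2 * a 4 - a 5) = lam + lam\<^sup>2 + lam ^ 3)"
proof (intro conjI)
  note quad = U_series_quadratic[OF assms] and cub = U_series_cubic[OF assms]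
  show "\<forall>f\<in>U_plus lam.
            let a = taylor_coeff f in
              a 2 * a 3 - a 4 \<in> \<real> \<and>
              - (1 + lam) * lam \<le> Re (a 2 * a 3 - a 4) \<and>
              Re (a 2 * a 3 - a 4) \<le> lam / 2 \<and>
              cmod (a 2 * a 4 - a 5) \<le> lam + lam\<^sup>2 + lam ^ 3"
  proof
    fix f assume "f \<in> U_plus lam"
    then obtain b where b: "U_series lam b" "\<And>z. z \<in> ball 0 1 \<Longrightarrow> f z = z / eval_fps (real_fps b) z"
      using U_plusE by blast
    have "0 \<le> b 1" "0 \<le> b 2" "0 \<le> b 3" "0 \<le> b 4"
      using b(1) by (auto simp: U_series_def)
    note bounds = coeff_bounds[OF assms this U_series_weighted_sum[OF b(1)] U_series_b1_le[OF b(1)]]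
    show "let a = taylor_coeff f in
              a 2 * a 3 - a 4 \<in> \<real> \<and>
              - (1 + lam) * lam \<le> Re (a 2 * a 3 - a 4) \<and>
              Re (a 2 * a 3 - a 4) \<le> lam / 2 \<and>
              cmod (a 2 * a 4 - a 5) \<le> lam + lam\<^sup>2 + lam ^ 3"
      using bounds
      by (simp only: Let_def U_plus_coeffs[OF b] norm_of_real Re_complex_of_real Reals_of_real simp_thms)
  qed
  show "\<exists>f\<in>U_plus lam. let a = taylor_coeff f in
              a 2 * a 3 - a 4 = complex_of_real (- (1 + lam) * lam)"
    unfolding Let_def by (rule bexI[OF _ U_plusI[OF quad]], subst U_plus_coeffs(1)[OF quad refl])
      (simp add: eval_nat_numeral algebra_simps)
  show "\<exists>f\<in>U_plus lam. let a = taylor_coeff f in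
              a 2 * a 3 - a 4 = complex_of_real (lam / 2)"
    unfolding Let_def by (rule bexI[OF _ U_plusI[OF cub]], subst U_plus_coeffs(1)[OF cub refl])
      (simp add: eval_nat_numeral)
  \<comment> \<open>The left side is the second functional at b1 = 1 + lam, b2 = lam, b3 = b4 =
    0.\<close>
  have "(1 + lam)\<^sup>2 * lam - lam\<^sup>2 = lam + lam\<^sup>2 + lam ^ 3"
    by (simp add: power2_eq_square power3_eq_cube algebra_simps)
  moreover have "0 \<le> lam + lam\<^sup>2 + lam ^ 3"
    using assms by simp
  ultimately show "\<exists>f\<in>U_plus lam. let a = taylor_coeff f in
              cmod (a 2 * a 4 - a 5) = lam + lam\<^sup>2 + lam ^ 3"
    unfolding Let_def by (intro bexI[OF _ U_plusI[OF quad]], subst U_plus_coeffs(2)[OF quad refl])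
      (simp only: norm_of_real, simp add: eval_nat_numeral)
qed

end
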